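(* Let $\lambda,\delta$ be real numbers with $0\le\delta\le\lambda\le 1$, let $\varphi,\psi\in\mathcal N$, and let $f(z)=z+\sum_{n=2}^{\infty}a_nz^n$ belong to the class $\mathcal K_{\lambda,\delta}(\varphi,\psi)$. Then for every integer $n\ge 2$, $$\left[1+(n-1)(\lambda-\delta+2\lambda\delta)+(n-1)(n-2)\lambda\delta\right]|a_n|\le \frac{\prod_{j=0}^{n-2}\left(j+|\psi'(0)|\right)}{n!}+\frac{|\varphi'(0)|}{n}\left(1+\sum_{k=1}^{n-2}\frac{\prod_{j=0}^{n-k-2}\left(j+|\psi'(0)|\right)}{(n-k-1)!}\right).$$ (The sum over $k$ is empty, i.e. equal to $0$, when $n=2$.)
   Context: $\mathbb D=\{z\in\mathbb C:|z|<1\}$. $\mathcal A$ is the family of functions analytic in $\mathbb D$ of the form $f(z)=z+\sum_{n\ge2}a_nz^n$. For analytic $F,G$ on $\mathbb D$ with $F(0)=G(0)$, $F$ is subordinate to $G$, written $F\prec G$, if there is an analytic function $h$ on $\mathbb D$ with $h(0)=0$, $|h(z)|<1$ and $F(z)=G(h(z))$ for all $z\in\mathbb D$. $\mathcal N$ is the class of analytic univalent functions $\varphi:\mathbb D\to\mathbb C$ such that $\varphi(\mathbb D)$ is convex, $\varphi(0)=1$ and $\Re\varphi(z)>0$ for $z\in\mathbb D$. For $\psi\in\mathcal N$, $\mathcal K(\psi)$ is the class of $g\in\mathcal A$ such that $1+\frac{zg''(z)}{g'(z)}\prec\psi(z)$ in $\mathbb D$. For $0\le\delta\le\lambda\le1$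 and $\varphi,\psi\in\mathcal N$, $\mathcal K_{\lambda,\delta}(\varphi,\psi)$ is the class of $f\in\mathcal A$ for which there exists $g\in\mathcal K(\psi)$ with $$\frac{f'(z)+(\lambda-\delta+2\lambda\delta)zf''(z)+\lambda\delta z^2f'''(z)}{g'(z)}\prec\varphi(z)\qquad(z\in\mathbb D).$$ *)

theory Defs
  imports "HOL-Complex_Analysis.Complex_Analysis"
begin

abbreviation unit_disc :: "complex set" where
  "unit_disc \<equiv> ball 0 1"

text \<open>
  Functions on the disc are total functions on the complex numbers; their values outside
  \<open>unit_disc\<close> are irrelevant, since only values and derivatives at points of this open set are used.
\<close>

definition normalized_expansion :: "(complex \<Rightarrow> complex) \<Rightarrow> (nat \<Rightarrow> complex) \<Rightarrow> bool" where
  \<comment> \<open>\<open>f z = z + (\<Sum>n\<ge>2. a n * z ^ n)\<close>; the values \<open>a 0\<close> and \<open>a 1\<close> play no role\<close>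
  "normalized_expansion f a \<longleftrightarrow>
     (\<forall>z\<in>unit_disc. (\<lambda>n. a (n + 2) * z ^ (n + 2)) sums (f z - z))"

definition class_A :: "(complex \<Rightarrow> complex) set" where
  "class_A = {f. f analytic_on unit_disc \<and> (\<exists>a. normalized_expansion f a)}"

definition subordinate :: "(complex \<Rightarrow> complex) \<Rightarrow> (complex \<Rightarrow> complex) \<Rightarrow> bool" where
  "subordinate F G \<longleftrightarrow>
     F analytic_on unit_disc \<and> G analytic_on unit_disc \<and> F 0 = G 0 \<and>
     (\<exists>h. h analytic_on unit_disc \<and> h 0 = 0 \<and>
          (\<forall>z\<in>unit_disc. norm (h z) < 1 \<and> F z = G (h z)))"

definition class_N :: "(complex \<Rightarrow> complex) set" where
  "class_N = {\<phi>. \<phi> analytic_on unit_disc \<and> inj_on \<phi> unit_disc \<and> convex (\<phi> ` unit_disc) \<and>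
                  \<phi> 0 = 1 \<and> (\<forall>z\<in>unit_disc. Re (\<phi> z) > 0)}"

text \<open>
  The condition that \<open>deriv g\<close> has no zeros is implicit in the quotient being an analytic
  function on the disc; it is spelled out because division by zero is total in HOL.
\<close>

definition class_K :: "(complex \<Rightarrow> complex) \<Rightarrow> (complex \<Rightarrow> complex) set" where
  "class_K \<psi> = {g \<in> class_A. (\<forall>z\<in>unit_disc. deriv g z \<noteq> 0) \<and>
                  subordinate (\<lambda>z. 1 + z * (deriv ^^ 2) g z / deriv g z) \<psi>}"

definition class_K2 ::
  "real \<Rightarrow> real \<Rightarrow> (complex \<Rightarrow> complex) \<Rightarrow> (complex \<Rightarrow> complex) \<Rightarrow> (complex \<Rightarrow> complex) set" where
  "class_K2 lam \<delta> \<phi> \<psi> = {f \<in> class_A. \<exists>g \<in> class_K \<psi>.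
     subordinate
       (\<lambda>z. (deriv f z
              + of_real (lam - \<delta> + 2 * lam * \<delta>) * z * (deriv ^^ 2) f z
              + of_real (lam * \<delta>) * z ^ 2 * (deriv ^^ 3) f z) / deriv g z)
       \<phi>}"

end

theory Submission
  imports Defs
begin

text \<open>
  The coefficients of a function subordinate to a convex univalent \<open>G\<close> are bounded by
  \<open>\<bar>G' 0\<bar>\<close> (Rogosinski): averaging over the \<open>n\<close>-th roots of unity kills the coefficients of index
  \<open>1, \<dots>, n - 1\<close>, keeps the \<open>n\<close>-th one, and stays in the image of \<open>G\<close> by convexity, so \<open>G\<^sup>-\<^sup>1\<close> of
  the average is a self-map of the disc to which Cauchy's estimate applies.
  Comparing coefficients in \<open>z g'' = g' (p - 1)\<close> with \<open>p \<prec> \<psi>\<close> bounds the coefficients of \<open>g'\<close>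
  recursively; comparing coefficients in the relation defining the class then bounds those of \<open>f\<close>.
\<close>

section \<open>Coefficients of subordinate functions\<close>

text \<open>Exchanging the exponents turns each sum into a geometric one with ratio
  \<open>\<omega> ^ m\<close>, an n-th root of unity that differs from 1 unless n divides m.\<close>

lemma sum_powers_root_of_unity:
  fixes \<omega> :: complex
  assumes "\<omega> = exp (2 * of_real pi * \<i> / of_nat n)" "n > 0"
  shows "0 < m \<Longrightarrow> m < n \<Longrightarrow> (\<Sum>k<n. (\<omega> ^ k) ^ m) = 0"
    and "(\<Sum>k<n. (\<omega> ^ k) ^ n) = of_nat n"
    and "norm \<omega> = 1"
proof -
  have pw: "\<omega> ^ m = exp (2 * of_real pi * \<i> * of_nat m / of_nat n)" for m
    unfolding assms(1) exp_of_nat_mult[symmetric] by (simp add: mult_ac)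
  have one: "\<omega> ^ n = 1"
    using complex_root_unity[of n 1] assms by simp
  have swap: "(\<omega> ^ k) ^ m = (\<omega> ^ m) ^ k" for k m
    by (simp add: power_mult[symmetric] mult.commute)
  show "(\<Sum>k<n. (\<omega> ^ k) ^ m) = 0" if "0 < m" "m < n"
  proof -
    have "\<omega> ^ m \<noteq> 1"
      unfolding pw using complex_root_unity_eq_1[of n m] that by (auto dest: dvd_imp_le)
    moreover have "(\<omega> ^ m) ^ n = 1"
      by (subst swap) (simp add: one)
    ultimately have "(\<Sum>k<n. (\<omega> ^ m) ^ k) = 0"
      by (simp add: geometric_sum)
    then show ?thesis
      by (subst swap)
  qed
  show "(\<Sum>k<n. (\<omega> ^ k) ^ n) = of_nat n"
    by (subst swap) (simp add: one)
  show "norm \<omega> = 1"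
    unfolding assms(1) by (simp add: norm_exp_eq_Re)
qed

text \<open>Nothing is known about \<open>w\<close> on the unit circle, so Cauchy's estimate is
  applied at each radius r < 1 and r then tends to 1 from the left.\<close>

lemma norm_fps_nth_le_if_bounded_on_disc:
  assumes "w holomorphic_on unit_disc" "\<And>z. z \<in> unit_disc \<Longrightarrow> norm (w z) \<le> B"
    and "w has_fps_expansion W"
  shows "norm (fps_nth W n) \<le> B"
proof -
  have *: "norm (fps_nth W n) * r ^ n \<le> B" if r: "0 < r" "r < 1" for r :: real
  proof -
    have "norm ((deriv ^^ n) w 0) \<le> fact n * B / r ^ n"
    proof (rule Cauchy_inequality)
      show "w holomorphic_on ball 0 r"
        by (rule holomorphic_on_subset[OF assms(1)]) (use r in auto)
      show "continuous_on (cball 0 r) w"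
        by (rule holomorphic_on_imp_continuous_on[OF holomorphic_on_subset[OF assms(1)]])
          (use r in auto)
    qed (use r assms(2) in auto)
    then show ?thesis
      using r by (simp add: fps_nth_fps_expansion[OF assms(3)] norm_divide field_simps)
  qed
  have "((\<lambda>r. norm (fps_nth W n) * r ^ n) \<longlongrightarrow> norm (fps_nth W n) * 1 ^ n) (at_left 1)"
    by (intro tendsto_intros)
  moreover have "eventually (\<lambda>r. norm (fps_nth W n) * r ^ n \<le> B) (at_left (1::real))"
    by (rule eventually_mono[OF eventually_at_left_real[of 0 1]]) (use * in auto)
  ultimately show ?thesis
    using tendsto_upperbound[of _ _ "at_left (1::real)"] by fastforce
qed

text \<open>Since \<open>b\<close> is divisible by \<open>fps_X ^ n\<close>, its powers with
  exponent i > 1 start at order n * i > n, and \<open>b ^ 0\<close> is constant; only the linear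
  term of \<open>A\<close> reaches index n.\<close>

lemma fps_compose_nth_of_high_order:
  fixes A b :: "'a::field fps"
  assumes "\<And>m. m < n \<Longrightarrow> fps_nth b m = 0" "n > 0"
  shows "fps_nth (A oo b) n = fps_nth A 1 * fps_nth b n"
proof -
  have b: "b = fps_X ^ n * fps_shift n b"
    by (rule fps_ext) (auto simp: fps_X_power_mult_nth assms(1))
  have z: "fps_nth (b ^ i) n = 0" if "i \<noteq> 1" for i
  proof (cases "i = 0")
    case False
    then have "n < n * i" using that assms(2) by (cases i) auto
    then show ?thesis
      by (subst b) (simp add: power_mult_distrib fps_X_power_mult_nth flip: power_mult)
  qed (use assms(2) in auto)
  have "fps_nth (A oo b) n = (\<Sum>i=0..n. if i = 1 then fps_nth A 1 * fps_nth b n else 0)"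
    unfolding fps_compose_nth by (intro sum.cong refl) (use z in auto)
  also have "\<dots> = fps_nth A 1 * fps_nth b n"
    using assms(2) by simp
  finally show ?thesis .
qed

lemma norm_coeff_subordinate_convex_le:
  assumes sub: "subordinate F G" and inj: "inj_on G unit_disc" and conv: "convex (G ` unit_disc)"
    and P: "F has_fps_expansion P" and n: "n > 0"
  shows "norm (fps_nth P n) \<le> norm (deriv G 0)"
proof -
  from sub obtain h where h: "\<And>z. z \<in> unit_disc \<Longrightarrow> norm (h z) < 1 \<and> F z = G (h z)"
    unfolding subordinate_def by blast
  have holF: "F holomorphic_on unit_disc" and holG: "G holomorphic_on unit_disc" and FG: "F 0 = G 0"
    using sub by (auto simp: subordinate_def intro: analytic_imp_holomorphic)
  obtain Gi where Gi: "Gi holomorphic_on G ` unit_disc"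
      "\<And>z. z \<in> unit_disc \<Longrightarrow> deriv G z * deriv Gi (G z) = 1"
      "\<And>z. z \<in> unit_disc \<Longrightarrow> Gi (G z) = z"
    using holomorphic_has_inverse[OF holG open_ball inj] by metis
  have openG: "open (G ` unit_disc)"
    by (rule open_mapping_thm3[OF holG open_ball inj])
  define \<omega> where "\<omega> = exp (2 * of_real pi * \<i> / of_nat n)"
  note \<omega> = sum_powers_root_of_unity[OF \<omega>_def n]
  have rot: "\<omega> ^ k * z \<in> unit_disc" if "z \<in> unit_disc" for k z
    using that by (simp add: norm_mult norm_power \<omega>(3))
  \<comment> \<open>The average of the n rotations of F. Its equal weights sum to 1, so each value
    is a convex combination of points of the image of G.\<close>
  define H where "H = (\<lambda>z. \<Sum>k<n. (1 / of_nat n) * F (\<omega> ^ k * z))"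
  have HG: "H z \<in> G ` unit_disc" if z: "z \<in> unit_disc" for z
  proof -
    have "(\<Sum>k<n. (1 / real n) *\<^sub>R F (\<omega> ^ k * z)) \<in> G ` unit_disc"
    proof (rule convex_sum[OF _ conv])
      show "F (\<omega> ^ k * z) \<in> G ` unit_disc" for k
        using h[OF rot[OF z]] by auto
    qed (use n in auto)
    then show ?thesis
      by (simp add: H_def scaleR_conv_of_real)
  qed
  have holH: "H holomorphic_on unit_disc"
  proof -
    have "(\<lambda>z. F (\<omega> ^ k * z)) holomorphic_on unit_disc" for k
      using holomorphic_on_compose_gen[OF _ holF, of "\<lambda>z. \<omega> ^ k * z" unit_disc] rot
      unfolding o_def image_subset_iff by (blast intro: holomorphic_intros)
    then show ?thesis
      unfolding H_def by (intro holomorphic_intros)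
  qed
  define Q where "Q = (\<Sum>k<n. fps_const (1 / of_nat n) * (P oo (fps_const (\<omega> ^ k) * fps_X)))"
  have HQ: "H has_fps_expansion Q"
    unfolding H_def Q_def
  proof (intro has_fps_expansion_sum has_fps_expansion_cmult_left)
    fix k
    have "(\<lambda>z. \<omega> ^ k * z) has_fps_expansion fps_const (\<omega> ^ k) * fps_X"
      by (intro fps_expansion_intros)
    from has_fps_expansion_compose[OF P this]
    show "(\<lambda>z. F (\<omega> ^ k * z)) has_fps_expansion (P oo (fps_const (\<omega> ^ k) * fps_X))"
      by (simp add: o_def)
  qed
  have Qn: "fps_nth Q m = (\<Sum>k<n. (\<omega> ^ k) ^ m) * fps_nth P m / of_nat n" for m
    by (simp add: Q_def fps_sum_nth fps_compose_linear sum_distrib_right sum_divide_distrib)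
  have H0: "H 0 = G 0"
    using n by (simp add: H_def FG)
  have Q0: "fps_nth Q 0 = G 0"
    using HQ H0 by (metis has_fps_expansion_imp_0_eq_fps_nth_0)
  \<comment> \<open>Without its constant term the series vanishes to order n, and it can be composed
    with the expansion of \<open>Gi\<close> about \<open>G 0\<close>.\<close>
  define b where "b = Q - fps_const (G 0)"
  have b: "fps_nth b m = 0" if "m < n" for m
    using that \<omega>(1)[of m] Q0 by (cases "m = 0") (auto simp: b_def Qn)
  have bn: "fps_nth b n = fps_nth P n"
    using n by (simp add: b_def Qn \<omega>(2))
  have Hb: "(\<lambda>z. H z - G 0) has_fps_expansion b"
    unfolding b_def by (intro fps_expansion_intros HQ)
  define A where "A = fps_expansion Gi (G 0)"
  have "Gi analytic_on {G 0}"
    using Gi(1) openG by (meson analytic_at centre_in_ball image_eqI zero_less_one)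
  then have A: "(\<lambda>u. Gi (G 0 + u)) has_fps_expansion A"
    unfolding A_def by (rule analytic_at_imp_has_fps_expansion)
  \<comment> \<open>The linear coefficient of the inverse is 1 / G'(0); this is where the constant
    in the bound comes from.\<close>
  have A1: "deriv G 0 * fps_nth A 1 = 1"
    using Gi(2)[of 0] by (simp add: A_def fps_expansion_def)
  have W: "(\<lambda>z. Gi (H z)) has_fps_expansion (A oo b)"
    using has_fps_expansion_compose[OF A Hb b[OF n]] by (simp add: o_def)
  have "norm (fps_nth (A oo b) n) \<le> 1"
  proof (rule norm_fps_nth_le_if_bounded_on_disc[OF _ _ W])
    show "(\<lambda>z. Gi (H z)) holomorphic_on unit_disc"
      using holomorphic_on_compose_gen[OF holH Gi(1)] HG unfolding o_def image_subset_iff by blast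
    show "norm (Gi (H z)) \<le> 1" if "z \<in> unit_disc" for z
      using HG[OF that] Gi(3) by auto
  qed
  moreover have "fps_nth (A oo b) n = fps_nth A 1 * fps_nth P n"
    using fps_compose_nth_of_high_order[OF b n] bn by simp
  ultimately have "norm (deriv G 0) * norm (fps_nth A 1 * fps_nth P n) \<le> norm (deriv G 0) * 1"
    by (intro mult_left_mono) auto
  moreover have "norm (deriv G 0) * norm (fps_nth A 1 * fps_nth P n) = norm (fps_nth P n)"
    using A1 by (metis mult.assoc mult_1 norm_mult)
  ultimately show ?thesis by simp
qed

section \<open>Coefficients in the classes\<close>

text \<open>\<open>normalized_expansion\<close> leaves \<open>a 0\<close> and \<open>a 1\<close>
  unconstrained, so the series replaces them by the true coefficients 0 and 1.\<close>

lemma normalized_expansion_has_fps_expansion: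
  assumes "normalized_expansion f a"
  shows "f has_fps_expansion Abs_fps (\<lambda>n. if n = 0 then 0 else if n = 1 then 1 else a n)"
proof (rule has_fps_expansionI)
  have "(\<lambda>n. (if n = 0 then 0 else if n = 1 then 1 else a n) * z ^ n) sums f z"
    if "z \<in> unit_disc" for z
  proof -
    have "(\<lambda>n. a (n + 2) * z ^ (n + 2)) sums (f z - z)"
      using assms that by (auto simp: normalized_expansion_def)
    then show ?thesis
      by (subst sums_iff_shift'[of _ 2, symmetric]) (simp add: numeral_2_eq_2)
  qed
  moreover have "eventually (\<lambda>z. z \<in> unit_disc) (nhds (0::complex))"
    by (intro eventually_nhds_in_open) auto
  ultimately show "eventually (\<lambda>z. (\<lambda>n. fps_nth (Abs_fps (\<lambda>n. if n = 0 then 0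
      else if n = 1 then 1 else a n)) n * z ^ n) sums f z) (nhds 0)"
    by (auto elim!: eventually_mono)
qed

lemma has_fps_expansion_eq_on_disc:
  fixes u v :: "complex \<Rightarrow> complex"
  assumes "u has_fps_expansion U" "v has_fps_expansion V" "\<And>z. z \<in> unit_disc \<Longrightarrow> u z = v z"
  shows "U = V"
proof -
  have "eventually (\<lambda>z. z \<in> unit_disc) (nhds (0::complex))"
    by (intro eventually_nhds_in_open) auto
  then have "eventually (\<lambda>z. u z = v z) (nhds 0)"
    by (rule eventually_mono) (use assms(3) in auto)
  then have "u has_fps_expansion V"
    using assms(2) by (subst has_fps_expansion_cong) auto
  with assms(1) show ?thesis by (rule fps_expansion_unique_complex)
qed

lemma norm_coeff_subordinate_class_N_le:
  assumes "subordinate F \<psi>" "\<psi> \<in> class_N"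
  obtains P where "F has_fps_expansion P" "fps_nth P 0 = 1"
    "\<And>n. n > 0 \<Longrightarrow> norm (fps_nth P n) \<le> norm (deriv \<psi> 0)"
proof -
  have F: "F analytic_on unit_disc" "F 0 = 1"
    using assms by (auto simp: subordinate_def class_N_def)
  have P: "F has_fps_expansion fps_expansion F 0"
    by (rule analytic_at_imp_has_fps_expansion_0) (rule analytic_on_subset[OF F(1)], simp)
  show ?thesis
  proof (rule that[OF P])
    show "fps_nth (fps_expansion F 0) 0 = 1"
      using F(2) by (simp add: fps_expansion_def)
  qed (use norm_coeff_subordinate_convex_le[OF assms(1) _ _ P] assms(2) in \<open>auto simp: class_N_def\<close>)
qed

text \<open>The quotients are the coefficients of (1 - z)^(-B), and this is the recursion obtained
  from z y' = B y z / (1 - z). It is the equality case of the estimate for the coefficients of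
  g'.\<close>

lemma rising_product_recurrence:
  fixes B :: real
  shows "B * (\<Sum>k<m. (\<Prod>j<k. real j + B) / fact k) = real m * ((\<Prod>j<m. real j + B) / fact m)"
proof (induction m)
  case (Suc m)
  have "B * (\<Sum>k<Suc m. (\<Prod>j<k. real j + B) / fact k) = (real m + B) * ((\<Prod>j<m. real j + B) / fact m)"
    by (simp add: distrib_left Suc distrib_right add_divide_distrib)
  then show ?case by (simp add: mult_ac del: of_nat_Suc)
qed simp

text \<open>The bound is stated for g' because only g' enters the quotient defining
  \<open>class_K2\<close>. The recursion for its coefficients is majorized by that of (1 -
  z)^(-B).\<close>

lemma class_K_deriv_coeff_bound:
  assumes g: "g \<in> class_K \<psi>" and \<psi>: "\<psi> \<in> class_N"
  obtains D where "deriv g has_fps_expansion D" "fps_nth D 0 = 1"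
    "\<And>m. norm (fps_nth D m) \<le> (\<Prod>j<m. real j + norm (deriv \<psi> 0)) / fact m"
proof -
  let ?B = "norm (deriv \<psi> 0)"
  from g obtain b where "normalized_expansion g b"
    by (auto simp: class_K_def class_A_def)
  from normalized_expansion_has_fps_expansion[OF this]
  obtain E where E: "g has_fps_expansion E" "fps_nth E 1 = 1"
    by force
  have nz: "\<And>z. z \<in> unit_disc \<Longrightarrow> deriv g z \<noteq> 0"
    and sub: "subordinate (\<lambda>z. 1 + z * (deriv ^^ 2) g z / deriv g z) \<psi>"
    using g by (auto simp: class_K_def)
  obtain P where P: "(\<lambda>z. 1 + z * (deriv ^^ 2) g z / deriv g z) has_fps_expansion P"
      "fps_nth P 0 = 1" "\<And>n. n > 0 \<Longrightarrow> norm (fps_nth P n) \<le> ?B"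
    using norm_coeff_subordinate_class_N_le[OF sub \<psi>] by blast
  define D where "D = fps_deriv E"
  have D: "deriv g has_fps_expansion D"
    unfolding D_def by (intro fps_expansion_intros E)
  have D0: "fps_nth D 0 = 1"
    using E(2) by (simp add: D_def)
  \<comment> \<open>The relation z g'' = g' (p - 1), with the denominator cleared; this uses that g'
    has no zeros on the disc.\<close>
  have "fps_X * fps_deriv D = D * (P - 1)"
  proof (rule has_fps_expansion_eq_on_disc)
    show "(\<lambda>z. z * deriv (deriv g) z) has_fps_expansion fps_X * fps_deriv D"
      by (intro fps_expansion_intros D)
    show "(\<lambda>z. deriv g z * (1 + z * (deriv ^^ 2) g z / deriv g z - 1)) has_fps_expansion D * (P - 1)"
      by (intro fps_expansion_intros D P)
  qed (use nz in \<open>simp add: numeral_2_eq_2\<close>)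
  then have "fps_nth (fps_X * fps_deriv D) m = fps_nth (D * (P - 1)) m" for m
    by simp
  moreover have "fps_nth (fps_X * fps_deriv D) m = of_nat m * fps_nth D m" for m
    by (cases m) auto
  \<comment> \<open>As \<open>P - 1\<close> has no constant term, the summand k = m drops out and
    only earlier coefficients of \<open>D\<close> remain.\<close>
  moreover have "fps_nth (D * (P - 1)) m = (\<Sum>k<m. fps_nth D k * fps_nth P (m - k))" for m
    by (auto simp: fps_mult_nth P(2) atLeast0AtMost lessThan_Suc_atMost[symmetric] intro!: sum.cong)
  ultimately have rec: "of_nat m * fps_nth D m = (\<Sum>k<m. fps_nth D k * fps_nth P (m - k))" for m
    by metis
  have "norm (fps_nth D m) \<le> (\<Prod>j<m. real j + ?B) / fact m" for m
  proof (induction m rule: less_induct)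
    case (less m)
    show ?case
    proof (cases "m = 0")
      case False
      have "real m * norm (fps_nth D m) = norm (of_nat m * fps_nth D m)"
        by (simp add: norm_mult)
      also have "\<dots> \<le> (\<Sum>k<m. norm (fps_nth D k) * norm (fps_nth P (m - k)))"
        unfolding rec norm_mult[symmetric] by (rule norm_sum)
      also have "\<dots> \<le> (\<Sum>k<m. ((\<Prod>j<k. real j + ?B) / fact k) * ?B)"
        by (intro sum_mono mult_mono less P(3)) (auto intro!: divide_nonneg_nonneg prod_nonneg)
      also have "\<dots> = real m * ((\<Prod>j<m. real j + ?B) / fact m)"
        unfolding rising_product_recurrence[symmetric] by (simp add: sum_distrib_left mult.commute)
      finally show ?thesis
        using False by (simp only: mult_le_cancel_left_pos of_nat_0_less_iff neq0_conv)
    qed (simp add: D0)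
  qed
  with D D0 show ?thesis by (rule that)
qed

theorem theorem3:
  fixes lam \<delta> :: real
    and \<phi> \<psi> f :: "complex \<Rightarrow> complex"
    and a :: "nat \<Rightarrow> complex"
    and n :: nat
  assumes "0 \<le> \<delta>" and "\<delta> \<le> lam" and "lam \<le> 1"
    and "\<phi> \<in> class_N" and "\<psi> \<in> class_N"
    and "f \<in> class_K2 lam \<delta> \<phi> \<psi>"
    and "normalized_expansion f a"
    and "n \<ge> 2"
  shows "(1 + (real n - 1) * (lam - \<delta> + 2 * lam * \<delta>) + (real n - 1) * (real n - 2) * (lam * \<delta>))
           * norm (a n)
         \<le> (\<Prod>j=0..n-2. real j + norm (deriv \<psi> 0)) / fact n
           + norm (deriv \<phi> 0) / real n *
             (1 + (\<Sum>k=1..n-2. (\<Prod>j=0..n-k-2. real j + norm (deriv \<psi> 0)) / fact (n - k - 1)))"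
proof -
  let ?B = "norm (deriv \<psi> 0)" and ?C = "norm (deriv \<phi> 0)"
  define \<alpha> where "\<alpha> = lam - \<delta> + 2 * lam * \<delta>"
  define \<beta> where "\<beta> = lam * \<delta>"
  define L where "L = 1 + (real n - 1) * \<alpha> + (real n - 1) * (real n - 2) * \<beta>"
  define R where "R m = (\<Prod>j<m. real j + ?B) / fact m" for m
  have "\<alpha> \<ge> 0" "\<beta> \<ge> 0"
    using assms(1,2) by (auto simp: \<alpha>_def \<beta>_def)
  then have L: "L \<ge> 0"
    using assms(8) by (auto simp: L_def)
  \<comment> \<open>Writing n as m + 2 avoids truncated subtraction in the indices below.\<close>
  obtain m where m: "n = m + 2"
    using assms(8) by (metis add.commute le_Suc_ex)
  define N where "N = (\<lambda>z. deriv f z + of_real \<alpha> * z * (deriv ^^ 2) f z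
    + of_real \<beta> * z ^ 2 * (deriv ^^ 3) f z)"
  from assms(6) obtain g where g: "g \<in> class_K \<psi>" and sub: "subordinate (\<lambda>z. N z / deriv g z) \<phi>"
    by (auto simp: class_K2_def N_def \<alpha>_def \<beta>_def)
  have nz: "\<And>z. z \<in> unit_disc \<Longrightarrow> deriv g z \<noteq> 0"
    using g by (auto simp: class_K_def)
  obtain D where D: "deriv g has_fps_expansion D" "fps_nth D 0 = 1"
    "\<And>m. norm (fps_nth D m) \<le> R m"
    using class_K_deriv_coeff_bound[OF g assms(5)] unfolding R_def by blast
  obtain Q where Q: "(\<lambda>z. N z / deriv g z) has_fps_expansion Q" "fps_nth Q 0 = 1"
    "\<And>n. n > 0 \<Longrightarrow> norm (fps_nth Q n) \<le> ?C"
    using norm_coeff_subordinate_class_N_le[OF sub assms(4)] by blast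
  define A where "A = Abs_fps (\<lambda>n. if n = 0 then 0 else if n = 1 then 1 else a n)"
  have A: "f has_fps_expansion A"
    unfolding A_def by (rule normalized_expansion_has_fps_expansion[OF assms(7)])
  define M where "M = fps_deriv A + fps_const (of_real \<alpha>) * (fps_X * fps_deriv (fps_deriv A))
    + fps_const (of_real \<beta>) * (fps_X ^ 2 * fps_deriv (fps_deriv (fps_deriv A)))"
  have "M = D * Q"
  proof (rule has_fps_expansion_eq_on_disc)
    show "(\<lambda>z. deriv f z + of_real \<alpha> * (z * deriv (deriv f) z)
      + of_real \<beta> * (z ^ 2 * deriv (deriv (deriv f)) z)) has_fps_expansion M"
      unfolding M_def by (intro fps_expansion_intros A)
    show "(\<lambda>z. deriv g z * (N z / deriv g z)) has_fps_expansion D * Q"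
      by (intro fps_expansion_intros D Q)
  qed (use nz in \<open>simp add: N_def numeral_2_eq_2 numeral_3_eq_3\<close>)
  \<comment> \<open>Index m + 1 is n - 1: differentiation shifts \<open>a n\<close> there, and the
    three terms of \<open>M\<close> contribute it with factors n, n(n-1)\<alpha> and
    n(n-1)(n-2)\<beta>, which add up to n L.\<close>
  then have eq: "fps_nth M (m + 1) = fps_nth (D * Q) (m + 1)"
    by simp
  have "fps_nth M (m + 1) = of_real (real n * L) * a n"
    by (cases m) (simp_all add: M_def A_def m L_def fps_X_power_mult_nth algebra_simps numeral_2_eq_2)
  then have "real n * L * norm (a n) = norm (fps_nth (D * Q) (m + 1))"
    using L unfolding eq[symmetric] by (simp add: norm_mult)
  \<comment> \<open>The summand with \<open>fps_nth Q 0 = 1\<close> is split off, since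
    \<open>?C\<close> bounds only coefficients of positive index. It yields the first term of the
    final bound.\<close>
  also have "fps_nth (D * Q) (m + 1) = fps_nth D (m + 1) + (\<Sum>k\<le>m. fps_nth D k * fps_nth Q (m + 1 - k))"
    by (simp add: fps_mult_nth Q(2) atLeast0AtMost)
  also have "norm \<dots> \<le> norm (fps_nth D (m + 1)) + (\<Sum>k\<le>m. norm (fps_nth D k) * norm (fps_nth Q (m + 1 - k)))"
    unfolding norm_mult[symmetric] by (intro norm_triangle_le add_mono norm_sum order_refl)
  also have "\<dots> \<le> R (m + 1) + (\<Sum>k\<le>m. R k * ?C)"
  proof (intro add_mono sum_mono mult_mono D Q(3))
    show "0 \<le> R k" for k
      by (auto simp: R_def intro!: divide_nonneg_nonneg prod_nonneg)
  qed auto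
  \<comment> \<open>The isolated 1 is \<open>R 0\<close>, an empty product over
    \<open>fact 0\<close>.\<close>
  also have "(\<Sum>k\<le>m. R k * ?C) = ?C * (1 + (\<Sum>k=1..m. R k))"
    by (simp add: sum_distrib_left mult.commute sum.atLeast_Suc_atMost[of 0 m] R_def distrib_left
        flip: atLeast0AtMost)
  \<comment> \<open>Reversing the order of summation gives the indexing of the statement, with
    summand \<open>R (n - k - 1)\<close>.\<close>
  also have "(\<Sum>k=1..m. R k) = (\<Sum>k=1..m. R (m + 1 - k))"
    by (rule sum.reindex_bij_witness[of _ "\<lambda>k. m + 1 - k" "\<lambda>k. m + 1 - k"]) auto
  also have "\<dots> = (\<Sum>k=1..n-2. (\<Prod>j=0..n-k-2. real j + ?B) / fact (n - k - 1))"
  proof (intro sum.cong)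
    fix k assume "k \<in> {1..n-2}"
    then have "m + 1 - k = Suc (n - k - 2)" "n - k - 1 = m + 1 - k"
      using m by auto
    then show "R (m + 1 - k) = (\<Prod>j=0..n-k-2. real j + ?B) / fact (n - k - 1)"
      by (simp only: R_def lessThan_Suc_atMost atLeast0AtMost)
  qed (simp add: m)
  finally have "real n * L * norm (a n) \<le> R (m + 1)
    + ?C * (1 + (\<Sum>k=1..n-2. (\<Prod>j=0..n-k-2. real j + ?B) / fact (n - k - 1)))" .
  \<comment> \<open>Dividing by n turns the denominator (n-1)! of \<open>R (m + 1)\<close> into n!
    and \<open>?C\<close> into \<open>?C / real n\<close>.\<close>
  moreover have "fact n = real n * fact (m + 1)"
    by (simp add: m)
  then have "R (m + 1) = real n * ((\<Prod>j=0..n-2. real j + ?B) / fact n)"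
    by (simp add: R_def m lessThan_Suc_atMost atLeast0AtMost)
  ultimately have "real n * (L * norm (a n)) \<le> real n * ((\<Prod>j=0..n-2. real j + ?B) / fact n
    + ?C / real n * (1 + (\<Sum>k=1..n-2. (\<Prod>j=0..n-k-2. real j + ?B) / fact (n - k - 1))))"
    using m by (simp add: distrib_left mult.assoc)
  then show ?thesis
    using m unfolding L_def \<alpha>_def \<beta>_def by (subst (asm) mult_le_cancel_left_pos) auto
qed

end
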